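(* Let $V$ be an $L_1$ component such that the compiler ${\downarrow}^2_3$ preserves traces of the $L_2$ component ${\downarrow}^1_2V$, and suppose the trace relation is invertible. Then for every $L_2$ context $A$, $A\in\mathsf{TExploit}^1_2(V)$ implies ${\downarrow}^2_3A\in\mathsf{TExploit}^1_3(V)$.
   Context: There are three languages $L_1,L_2,L_3$. Each $L_i$ has whole programs, components, contexts, and a set of traces $\mathsf{Trace}^i$; behaviors are sets of traces. Linking a context $C$ with a component $U$ of the same language gives a whole program $C[U]$ (assumed always well-defined). Each whole program $P$ of $L_i$ has a behavior $B(P)\subseteq\mathsf{Trace}^i$. There are compilers ${\downarrow}^1_2$ (from $L_1$ to $L_2$) and ${\downarrow}^2_3$ (from $L_2$ to $L_3$), each mapping whole programs, components and contexts to whole programs, components and contexts respectively, and each modular: $B({\downarrow}(C[U]))=B({\downarrow}C[{\downarrow}U])$. Their composite (first ${\downarrow}^1_2$, then ${\downarrow}^2_3$) is ${\downarrow}^1_3$. Arbitrary relations $\mapsto^1_2\subseteq\mathsf{Trace}^1\times\mathsf{Trace}^2$ and $\mapsto^2_3\subseteq\mathsf{Trace}^2\times\mathsf{Trace}^3$ are given, and $t^1\mapsto^1_3t^3$ means that there exists $t^2\in\mathsf{Trace}^2$ with $t^1\mapsto^1_2t^2$ and $t^2\mapsto^2_3t^3$. Attacker sets $\mathcal{A}_2$ of $L_2$ contexts and $\mathcal{A}_3$ of $L_3$ contexts are fixed, with ${\downarrow}^2_3A\in\mathcal{A}_3$ for all $A\in\mathcal{A}_2$. For $j\in\{2,3\}$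 and an $L_1$ component $V$, $$\mathsf{TExploit}^1_j(V)=\{A\in\mathcal{A}_j\mid\exists\,t^j\in B(A[{\downarrow}^1_jV]).\ \forall\, L_1\text{ contexts } C.\ \forall t^1\in B(C[V]).\ t^1\not\mapsto^1_jt^j\}.$$ The compiler ${\downarrow}^i_j$ preserves traces of an $L_i$ component $U$ if for every $L_i$ context $C$ and every $t^i\in B(C[U])$ there exists $t^j\in B({\downarrow}^i_jC[{\downarrow}^i_jU])$ with $t^i\mapsto^i_jt^j$. The trace relation is invertible if, whenever $t^1\mapsto^1_3t^3$, for all $t^2\in\mathsf{Trace}^2$ we have $t^1\mapsto^1_2t^2\iff t^2\mapsto^2_3t^3$. *)

theory Defs
  imports Main
begin

record ('whole, 'comp, 'ctx, 'trace) language =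
  link :: "'ctx \<Rightarrow> 'comp \<Rightarrow> 'whole"
  behavior :: "'whole \<Rightarrow> 'trace set"

record ('whole1, 'comp1, 'ctx1, 'whole2, 'comp2, 'ctx2) compiler =
  compile_whole :: "'whole1 \<Rightarrow> 'whole2"
  compile_comp :: "'comp1 \<Rightarrow> 'comp2"
  compile_ctx :: "'ctx1 \<Rightarrow> 'ctx2"

definition modular ::
  "('w1, 'u1, 'c1, 't1) language \<Rightarrow> ('w2, 'u2, 'c2, 't2) language \<Rightarrow>
   ('w1, 'u1, 'c1, 'w2, 'u2, 'c2) compiler \<Rightarrow> bool" where
  "modular L1 L2 K \<longleftrightarrow>
     (\<forall>C U. behavior L2 (compile_whole K (link L1 C U)) =
            behavior L2 (link L2 (compile_ctx K C) (compile_comp K U)))"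

(* Diagrammatic order: K12 is run first. *)
definition compose_compilers ::
  "('w1, 'u1, 'c1, 'w2, 'u2, 'c2) compiler \<Rightarrow> ('w2, 'u2, 'c2, 'w3, 'u3, 'c3) compiler \<Rightarrow>
   ('w1, 'u1, 'c1, 'w3, 'u3, 'c3) compiler" where
  "compose_compilers K12 K23 =
     \<lparr> compile_whole = compile_whole K23 \<circ> compile_whole K12,
       compile_comp = compile_comp K23 \<circ> compile_comp K12,
       compile_ctx = compile_ctx K23 \<circ> compile_ctx K12 \<rparr>"

definition TExploit ::
  "('wi, 'ui, 'ci, 'ti) language \<Rightarrow> ('wj, 'uj, 'cj, 'tj) language \<Rightarrow>
   ('wi, 'ui, 'ci, 'wj, 'uj, 'cj) compiler \<Rightarrow> ('ti \<Rightarrow> 'tj \<Rightarrow> bool) \<Rightarrow>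
   'cj set \<Rightarrow> 'ui \<Rightarrow> 'cj set" where
  "TExploit Li Lj K R Attackers V =
     {A \<in> Attackers. \<exists>tj \<in> behavior Lj (link Lj A (compile_comp K V)).
        \<forall>C. \<forall>ti \<in> behavior Li (link Li C V). \<not> R ti tj}"

definition preserves_traces ::
  "('wi, 'ui, 'ci, 'ti) language \<Rightarrow> ('wj, 'uj, 'cj, 'tj) language \<Rightarrow>
   ('wi, 'ui, 'ci, 'wj, 'uj, 'cj) compiler \<Rightarrow> ('ti \<Rightarrow> 'tj \<Rightarrow> bool) \<Rightarrow> 'ui \<Rightarrow> bool" where
  "preserves_traces Li Lj K R U \<longleftrightarrow>
     (\<forall>C. \<forall>ti \<in> behavior Li (link Li C U).
        \<exists>tj \<in> behavior Lj (link Lj (compile_ctx K C) (compile_comp K U)). R ti tj)"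

definition invertible_trace_relation ::
  "('t1 \<Rightarrow> 't2 \<Rightarrow> bool) \<Rightarrow> ('t2 \<Rightarrow> 't3 \<Rightarrow> bool) \<Rightarrow> bool" where
  "invertible_trace_relation R12 R23 \<longleftrightarrow>
     (\<forall>t1 t3. (R12 OO R23) t1 t3 \<longrightarrow> (\<forall>t2. R12 t1 t2 \<longleftrightarrow> R23 t2 t3))"

end

theory Submission
  imports Defs
begin

text \<open>The trace \<open>t2\<close> that witnesses the exploit by \<open>A\<close> is carried by
  trace preservation to a target trace \<open>t3\<close> with \<open>R23 t2 t3\<close>, and
  \<open>t3\<close> witnesses the exploit by the compiled attacker. Any source trace explaining
  \<open>t3\<close> would, by invertibility, already explain \<open>t2\<close>.\<close>

theorem mainTheorem10:
  fixes L1 :: "('w1, 'u1, 'c1, 't1) language"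
    and L2 :: "('w2, 'u2, 'c2, 't2) language"
    and L3 :: "('w3, 'u3, 'c3, 't3) language"
    and K12 :: "('w1, 'u1, 'c1, 'w2, 'u2, 'c2) compiler"
    and K23 :: "('w2, 'u2, 'c2, 'w3, 'u3, 'c3) compiler"
    and R12 :: "'t1 \<Rightarrow> 't2 \<Rightarrow> bool"
    and R23 :: "'t2 \<Rightarrow> 't3 \<Rightarrow> bool"
    and \<A>2 :: "'c2 set"
    and \<A>3 :: "'c3 set"
    and V :: 'u1
  assumes "modular L1 L2 K12"
    and "modular L2 L3 K23"
    and "\<And>A. A \<in> \<A>2 \<Longrightarrow> compile_ctx K23 A \<in> \<A>3"
    and "preserves_traces L2 L3 K23 R23 (compile_comp K12 V)"
    and "invertible_trace_relation R12 R23"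
  shows "\<forall>A. A \<in> TExploit L1 L2 K12 R12 \<A>2 V \<longrightarrow>
    compile_ctx K23 A \<in> TExploit L1 L3 (compose_compilers K12 K23) (R12 OO R23) \<A>3 V"
proof (intro allI impI)
  fix A
  assume "A \<in> TExploit L1 L2 K12 R12 \<A>2 V"
  then obtain t2 where A: "A \<in> \<A>2"
    and t2: "t2 \<in> behavior L2 (link L2 A (compile_comp K12 V))"
    and exploit: "\<And>C t1. t1 \<in> behavior L1 (link L1 C V) \<Longrightarrow> \<not> R12 t1 t2"
    unfolding TExploit_def by blast
  obtain t3 where t3: "t3 \<in> behavior L3 (link L3 (compile_ctx K23 A)
      (compile_comp K23 (compile_comp K12 V)))"
    and "R23 t2 t3"
    using assms(4) t2 unfolding preserves_traces_def by blast
  \<comment> \<open>The composite could relate \<open>t1\<close> to \<open>t3\<close> through a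
    middle trace other than \<open>t2\<close>. Invertibility, read at \<open>t2\<close> from right
    to left, still turns \<open>R23 t2 t3\<close> into the excluded
    \<open>R12 t1 t2\<close>.\<close>
  have "\<not> (R12 OO R23) t1 t3" if "t1 \<in> behavior L1 (link L1 C V)" for C t1
    using assms(5) \<open>R23 t2 t3\<close> exploit[OF that]
    unfolding invertible_trace_relation_def by blast
  then show "compile_ctx K23 A \<in>
      TExploit L1 L3 (compose_compilers K12 K23) (R12 OO R23) \<A>3 V"
    \<comment> \<open>Unfolding the composite compiler turns its image of \<open>V\<close> into the
      nested compilation in \<open>t3\<close>.\<close>
    using assms(3)[OF A] t3 unfolding TExploit_def compose_compilers_def by auto
qed

end
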